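(* Let $X$ be a Banach space. Assume that $L_1=L_1[0,1]$ bi-Lipschitz embeds into $X$. Then $X$ fails the Slice PCP.
   Context: All Banach spaces are real. An open half-space of $X$ is a set $\{x\in X: x^*(x)>a\}$ with $x^*\in X^*$, $a\in\mathbb{R}$. $X$ has the Slice PCP (Slice Point of Continuity Property) if for any nonempty bounded subset $A$ of $X$ and any $\varepsilon>0$ there exists an open half-space $S$ such that $S\cap A\ne\emptyset$ and any $x\in S\cap A$ admits a weak neighborhood $V$ satisfying $\operatorname{diam}(V\cap A)<\varepsilon$. *)

theory Defs
  imports "HOL-Analysis.Analysis"
begin

definition L1_rel :: "(real \<Rightarrow> real) \<Rightarrow> (real \<Rightarrow> real) \<Rightarrow> bool" where
  "L1_rel f g \<longleftrightarrow> integrable (lebesgue_on {0..1}) f \<and> integrable (lebesgue_on {0..1}) g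
     \<and> (AE t in lebesgue_on {0..1}. f t = g t)"

lemma part_equivp_L1_rel: "part_equivp L1_rel"
proof (rule part_equivpI)
  show "\<exists>f. L1_rel f f"
    by (rule exI[of _ "\<lambda>_. 0"]) (simp add: L1_rel_def)
  show "symp L1_rel"
    by (auto simp: symp_def L1_rel_def elim: eventually_mono)
  show "transp L1_rel"
    by (auto simp: transp_def L1_rel_def elim: eventually_elim2)
qed

quotient_type L1 = "real \<Rightarrow> real" / partial: L1_rel
  by (rule part_equivp_L1_rel)

instantiation L1 :: real_normed_vector
begin

lift_definition zero_L1 :: L1 is "\<lambda>_. 0"
  by (simp add: L1_rel_def)

lift_definition plus_L1 :: "L1 \<Rightarrow> L1 \<Rightarrow> L1" is "\<lambda>f g t. f t + g t"
  unfolding L1_rel_def by (auto elim: eventually_elim2)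

lift_definition minus_L1 :: "L1 \<Rightarrow> L1 \<Rightarrow> L1" is "\<lambda>f g t. f t - g t"
  unfolding L1_rel_def by (auto elim: eventually_elim2)

lift_definition uminus_L1 :: "L1 \<Rightarrow> L1" is "\<lambda>f t. - f t"
  unfolding L1_rel_def by (auto elim: eventually_mono)

lift_definition scaleR_L1 :: "real \<Rightarrow> L1 \<Rightarrow> L1" is "\<lambda>r f t. r * f t"
  unfolding L1_rel_def by (auto elim: eventually_mono)

lift_definition norm_L1 :: "L1 \<Rightarrow> real" is "\<lambda>f. \<integral>t. \<bar>f t\<bar> \<partial>lebesgue_on {0..1}"
  unfolding L1_rel_def by (rule integral_cong_AE) (auto elim: eventually_mono)

definition dist_L1 :: "L1 \<Rightarrow> L1 \<Rightarrow> real" where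
  "dist_L1 u v = norm (u - v)"

definition sgn_L1 :: "L1 \<Rightarrow> L1" where
  "sgn_L1 u = inverse (norm u) *\<^sub>R u"

definition uniformity_L1 :: "(L1 \<times> L1) filter" where
  "uniformity_L1 = (INF e\<in>{0<..}. principal {(u, v). dist u v < e})"

definition open_L1 :: "L1 set \<Rightarrow> bool" where
  "open_L1 U \<longleftrightarrow> (\<forall>u\<in>U. \<forall>\<^sub>F (u', v) in uniformity. u' = u \<longrightarrow> v \<in> U)"

instance
proof
  fix u v w :: L1 and r s :: real and U :: "L1 set"
  show "u + v + w = u + (v + w)"
    by transfer (simp add: L1_rel_def algebra_simps)
  show "u + v = v + u"
    by transfer (simp add: L1_rel_def algebra_simps)
  show "0 + u = u"
    by transfer (simp add: L1_rel_def)
  show "- u + u = 0"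
    by transfer (simp add: L1_rel_def)
  show "u - v = u + - v"
    by transfer (simp add: L1_rel_def)
  show "r *\<^sub>R (u + v) = r *\<^sub>R u + r *\<^sub>R v"
    by transfer (simp add: L1_rel_def algebra_simps)
  show "(r + s) *\<^sub>R u = r *\<^sub>R u + s *\<^sub>R u"
    by transfer (simp add: L1_rel_def algebra_simps)
  show "r *\<^sub>R s *\<^sub>R u = (r * s) *\<^sub>R u"
    by transfer (simp add: L1_rel_def algebra_simps)
  show "1 *\<^sub>R u = u"
    by transfer (simp add: L1_rel_def)
  show "norm u = 0 \<longleftrightarrow> u = 0"
    by transfer (simp add: L1_rel_def integral_nonneg_eq_0_iff_AE)
  show "norm (u + v) \<le> norm u + norm v"
  proof transfer
    fix f g :: "real \<Rightarrow> real"
    assume "L1_rel f f" "L1_rel g g"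
    then have f: "integrable (lebesgue_on {0..1}) f" and g: "integrable (lebesgue_on {0..1}) g"
      by (auto simp: L1_rel_def)
    have "(\<integral>t. \<bar>f t + g t\<bar> \<partial>lebesgue_on {0..1}) \<le> (\<integral>t. \<bar>f t\<bar> + \<bar>g t\<bar> \<partial>lebesgue_on {0..1})"
      using f g by (intro integral_mono) auto
    then show "(\<integral>t. \<bar>f t + g t\<bar> \<partial>lebesgue_on {0..1})
        \<le> (\<integral>t. \<bar>f t\<bar> \<partial>lebesgue_on {0..1}) + (\<integral>t. \<bar>g t\<bar> \<partial>lebesgue_on {0..1})"
      using f g by simp
  qed
  show "norm (r *\<^sub>R u) = \<bar>r\<bar> * norm u"
    by transfer (simp add: abs_mult)
qed (simp_all add: dist_L1_def sgn_L1_def uniformity_L1_def open_L1_def)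

end

definition bilipschitz_embedding :: "('a::metric_space \<Rightarrow> 'b::metric_space) \<Rightarrow> bool" where
  "bilipschitz_embedding f \<longleftrightarrow>
     (\<exists>c>0. \<exists>C>0. \<forall>x y. c * dist x y \<le> dist (f x) (f y) \<and> dist (f x) (f y) \<le> C * dist x y)"

definition weak_topology :: "'a::real_normed_vector topology" where
  "weak_topology =
     topology_generated_by {\<phi> -` U | (\<phi> :: 'a \<Rightarrow> real) U. bounded_linear \<phi> \<and> open U}"

definition weak_neighborhood :: "'a::real_normed_vector \<Rightarrow> 'a set \<Rightarrow> bool" where
  "weak_neighborhood x V \<longleftrightarrow> (\<exists>U. openin weak_topology U \<and> x \<in> U \<and> U \<subseteq> V)"

text \<open>The zero functional is admitted, so the whole space counts as an open half-space.\<close>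

definition open_halfspace :: "'a::real_normed_vector set \<Rightarrow> bool" where
  "open_halfspace S \<longleftrightarrow> (\<exists>(\<phi> :: 'a \<Rightarrow> real) a. bounded_linear \<phi> \<and> S = {x. \<phi> x > a})"

definition slice_PCP :: "'a::banach itself \<Rightarrow> bool" where
  "slice_PCP _ \<longleftrightarrow>
     (\<forall>(A :: 'a set) \<epsilon>. A \<noteq> {} \<and> bounded A \<and> 0 < \<epsilon> \<longrightarrow>
        (\<exists>S. open_halfspace S \<and> S \<inter> A \<noteq> {} \<and>
          (\<forall>x \<in> S \<inter> A. \<exists>V. weak_neighborhood x V \<and> diameter (V \<inter> A) < \<epsilon>)))"

end

theory Submission
  imports Defs
begin

text \<open>
  Let \<open>f\<close> embed \<open>L\<^sub>1\<close> with lower Lipschitz constant \<open>c\<close>. The property fails, with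
  \<open>\<epsilon> = c / 2\<close>, for the convex hull \<open>A\<close> of the set \<open>D\<close> of difference quotients
  \<open>(f u - f v) / \<parallel>u - v\<parallel>\<close> in which \<open>u - v\<close> is the indicator of a set of positive
  measure. The complement of an open half-space is convex, so a half-space that meets \<open>A\<close>
  already contains some \<open>x \<in> D\<close>. It is therefore enough that no \<open>x \<in> D\<close> has a weak
  neighborhood whose trace on \<open>A\<close> has diameter less than \<open>c / 2\<close>
  (\<open>quotient_not_weakly_continuous\<close>).

  Let \<open>x\<close> be the quotient of \<open>u\<close> and \<open>v\<close>, where \<open>u - v = 1\<^sub>E\<close>. For a set
  \<open>F \<subseteq> E\<close> of half the measure of \<open>E\<close>, the function \<open>m = v + 1\<^sub>F\<close> is a metric
  midpoint of \<open>u\<close> and \<open>v\<close>. Take two such midpoints \<open>m\<close> and \<open>m'\<close>. The quotient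
  of \<open>m\<close> and \<open>v\<close> and that of \<open>u\<close> and \<open>m'\<close> both lie in \<open>D\<close>, and their average is
  \<open>y = (f m - f v + f u - f m') / lam E = x + (f m - f m') / lam E\<close>. Its distance from \<open>x\<close> is at least \<open>c / 2\<close> as soon as the two halves of \<open>E\<close> are
  independent in \<open>E\<close>. For \<open>y\<close> to be weakly close to \<open>x\<close>, finitely many
  functionals must almost agree at \<open>f m\<close> and \<open>f m'\<close>. There are arbitrarily many pairwise
  independent halves of \<open>E\<close> (\<open>ex_independent_halves\<close>), all their images under \<open>f\<close>
  lie in one bounded set, and so such a pair exists by the pigeonhole principle
  (\<open>finitely_many_functionals_pigeonhole\<close>).
\<close>

section \<open>Independent halves of a measurable set\<close>

abbreviation lam :: "real set \<Rightarrow> real" where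
  "lam \<equiv> measure (lebesgue_on {0..1})"

abbreviation Meas :: "real set set" where
  "Meas \<equiv> sets (lebesgue_on {0..1::real})"

interpretation unit_interval: finite_measure "lebesgue_on {0..1::real}"
  by (rule finite_measure_lebesgue_on) simp

text \<open>
  The part of \<open>E\<close> to the left of \<open>t\<close> has a measure that is 1-Lipschitz in \<open>t\<close>, so it
  takes the value \<open>lam E / 2\<close>.
\<close>

lemma measurable_halving:
  assumes E: "E \<in> Meas"
  shows "\<exists>F\<in>Meas. F \<subseteq> E \<and> lam F = lam E / 2"
proof -
  define g where "g t = lam (E \<inter> {..t})" for t
  have sub: "E \<subseteq> {0..1}"
    using sets.sets_into_space[OF E] by simp
  have [measurable]: "E \<inter> {s<..t} \<in> Meas" "E \<inter> {..t} \<in> Meas" for s t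
  proof -
    have *: "E \<in> sets lebesgue"
      using E by (simp add: sets_restrict_space_iff)
    show "E \<inter> {s<..t} \<in> Meas" "E \<inter> {..t} \<in> Meas"
      using * sub by (auto simp: sets_restrict_space_iff)
  qed
  have step: "\<bar>g t - g s\<bar> \<le> t - s" if "s \<le> t" for s t
  proof -
    have "E \<inter> {..t} = (E \<inter> {..s}) \<union> (E \<inter> {s<..t})" using that by auto
    then have "g t = g s + lam (E \<inter> {s<..t})"
      unfolding g_def by (simp add: unit_interval.finite_measure_Union disjoint_iff)
    moreover have "lam (E \<inter> {s<..t}) = measure lebesgue (E \<inter> {s<..t})"
      using sub by (intro measure_restrict_space) auto
    moreover have "measure lebesgue (E \<inter> {s<..t}) \<le> measure lebesgue {s<..t}"
      using E by (intro measure_mono_fmeasurable bounded_set_imp_lmeasurable)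
        (auto simp: sets_restrict_space_iff)
    moreover have "measure lebesgue {s<..t} = t - s"
      using that by simp
    ultimately show ?thesis by simp
  qed
  have "\<bar>g t - g s\<bar> \<le> \<bar>t - s\<bar>" for s t
    using step[of s t] step[of t s] by linarith
  then have "1-lipschitz_on {0..1} g"
    by (intro lipschitz_onI) (auto simp: dist_real_def)
  then have "continuous_on {0..1} g"
    by (rule lipschitz_on_continuous_on)
  moreover have "g 0 \<le> lam E / 2"
  proof -
    have "E \<inter> {..0} \<subseteq> {0}" using sub by auto
    then have "measure lebesgue (E \<inter> {..0}) \<le> measure lebesgue {0::real}"
      using E by (intro measure_mono_fmeasurable bounded_set_imp_lmeasurable)
        (auto simp: sets_restrict_space_iff)
    moreover have "g 0 = measure lebesgue (E \<inter> {..0})"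
      unfolding g_def using sub by (intro measure_restrict_space) auto
    ultimately have "g 0 \<le> 0" by simp
    also have "0 \<le> lam E / 2" by simp
    finally show ?thesis .
  qed
  moreover have "lam E / 2 \<le> g 1"
  proof -
    have "E \<inter> {..1} = E" using sub by auto
    then show ?thesis by (simp add: g_def)
  qed
  ultimately obtain t where "g t = lam E / 2"
    using IVT'[of g 0 "lam E / 2" 1] by auto
  then show ?thesis
    by (intro bexI[of _ "E \<inter> {..t}"]) (auto simp: g_def)
qed

text \<open>
  For sets of half the measure of \<open>E\<close>, the condition on the symmetric differences says that
  they are pairwise independent for the normalized measure on \<open>E\<close>, as are the sets on
  which the Rademacher functions equal 1. Symmetric differences are used because their measures
  are the distances of the indicators in \<open>L\<^sub>1\<close>.
\<close>

definition independent_halves :: "real set \<Rightarrow> nat \<Rightarrow> (nat \<Rightarrow> real set) \<Rightarrow> bool" where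
  "independent_halves E L H \<longleftrightarrow>
    (\<forall>i<L. H i \<in> Meas \<and> H i \<subseteq> E \<and> lam (H i) = lam E / 2)
    \<and> (\<forall>i<L. \<forall>j<L. i \<noteq> j \<longrightarrow> lam (sym_diff (H i) (H j)) = lam E / 2)"

lemma independent_halvesD:
  assumes "independent_halves E L H" "i < L"
  shows "H i \<in> Meas" "H i \<subseteq> E" "lam (H i) = lam E / 2"
    and "j < L \<Longrightarrow> i \<noteq> j \<Longrightarrow> lam (sym_diff (H i) (H j)) = lam E / 2"
  using assms by (auto simp: independent_halves_def)

text \<open>
  Halve \<open>E\<close> into \<open>F\<close> and \<open>G\<close>, and take a family of \<open>L\<close> independent halves in each of
  them. The unions \<open>P i \<union> Q i\<close> are again independent halves of \<open>E\<close>, and \<open>F\<close> itself can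
  be added to them because each union contains half of \<open>F\<close> and half of \<open>G\<close>.
\<close>

lemma ex_independent_halves:
  assumes "E \<in> Meas"
  shows "\<exists>H. independent_halves E L H"
  using assms
proof (induction L arbitrary: E)
  case 0
  then show ?case by (simp add: independent_halves_def)
next
  case (Suc L)
  note [measurable] = Suc.prems
  obtain F where F[measurable]: "F \<in> Meas" and FE: "F \<subseteq> E" and lF: "lam F = lam E / 2"
    using measurable_halving[OF Suc.prems] by blast
  define G where "G = E - F"
  have G[measurable]: "G \<in> Meas" unfolding G_def by measurable
  have lG: "lam G = lam E / 2"
    using unit_interval.finite_measure_Diff[OF Suc.prems F FE] lF by (simp add: G_def)
  obtain P where "independent_halves F L P"
    using Suc.IH[OF F] by blast
  note P = independent_halvesD[OF this]
  obtain Q where "independent_halves G L Q"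
    using Suc.IH[OF G] by blast
  note Q = independent_halvesD[OF this]
  have split: "lam (A \<union> B) = lam A + lam B"
    if "A \<subseteq> F" "B \<subseteq> G" "A \<in> Meas" "B \<in> Meas" for A B
    using that by (intro unit_interval.finite_measure_Union) (auto simp: G_def)
  define H where "H i = (if i < L then P i \<union> Q i else F)" for i
  have old_new: "lam (sym_diff (P i \<union> Q i) F) = lam E / 2" if "i < L" for i
  proof -
    have "sym_diff (P i \<union> Q i) F = (F - P i) \<union> Q i"
      using P(2)[OF that] Q(2)[OF that] by (auto simp: G_def)
    moreover have "lam (F - P i) = lam E / 4"
      using unit_interval.finite_measure_Diff[OF F P(1) P(2)] P(3) lF that by auto
    ultimately show ?thesis
      using split[of "F - P i" "Q i"] P(1)[OF that] Q(1-3)[OF that] lG by auto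
  qed
  have old_old: "lam (sym_diff (P i \<union> Q i) (P j \<union> Q j)) = lam E / 2"
    if "i < L" "j < L" "i \<noteq> j" for i j
  proof -
    have "sym_diff (P i \<union> Q i) (P j \<union> Q j) = sym_diff (P i) (P j) \<union> sym_diff (Q i) (Q j)"
      using P(2)[OF that(1)] P(2)[OF that(2)] Q(2)[OF that(1)] Q(2)[OF that(2)]
      unfolding G_def by blast
    moreover have "sym_diff (P i) (P j) \<subseteq> F" "sym_diff (Q i) (Q j) \<subseteq> G"
      using P(2)[OF that(1)] P(2)[OF that(2)] Q(2)[OF that(1)] Q(2)[OF that(2)] by blast+
    moreover have "sym_diff (P i) (P j) \<in> Meas" "sym_diff (Q i) (Q j) \<in> Meas"
      using P(1) Q(1) that by auto
    ultimately show ?thesis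
      using split P(4)[OF that] Q(4)[OF that] lF lG by simp
  qed
  have "H i \<in> Meas \<and> H i \<subseteq> E \<and> lam (H i) = lam E / 2" if "i < Suc L" for i
  proof (cases "i < L")
    case True
    then show ?thesis
      using P(1-3)[OF True] Q(1-3)[OF True] split[of "P i" "Q i"] FE lF lG
      by (auto simp: H_def G_def)
  next
    case False
    then show ?thesis using F FE lF by (simp add: H_def)
  qed
  moreover have "lam (sym_diff (H i) (H j)) = lam E / 2"
    if "i < Suc L" "j < Suc L" "i \<noteq> j" for i j
  proof (cases "i < L")
    case True
    then show ?thesis
      using old_old[of i j] old_new[of i] that by (auto simp: H_def)
  next
    case False
    then have "j < L" using that by simp
    then show ?thesis
      using old_new[of j] False by (simp add: H_def Un_commute)
  qed
  ultimately have "independent_halves E (Suc L) H"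
    by (simp add: independent_halves_def)
  then show ?case by blast
qed

section \<open>Indicators in the space of integrable functions\<close>

lift_definition ind :: "real set \<Rightarrow> L1" is
  "\<lambda>E. indicator (if E \<in> Meas then E else {})"
  by (auto simp: L1_rel_def unit_interval.emeasure_finite less_top[symmetric])

lemma norm_ind:
  assumes "E \<in> Meas"
  shows "norm (ind E) = lam E"
proof -
  have "E \<inter> {0..1} = E" using sets.sets_into_space[OF assms] by auto
  with assms show ?thesis by transfer simp
qed

lemma norm_ind_diff:
  assumes "E \<in> Meas" "F \<in> Meas"
  shows "norm (ind E - ind F) = lam (sym_diff E F)"
  using assms
proof transfer
  fix E F assume EF: "E \<in> Meas" "F \<in> Meas"
  have "\<bar>indicator E t - indicator F t\<bar> = (indicator (sym_diff E F) t :: real)" for t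
    by (auto simp: indicator_def)
  moreover have "sym_diff E F \<inter> {0..1} = sym_diff E F"
    using sets.sets_into_space[OF EF(1)] sets.sets_into_space[OF EF(2)] by auto
  ultimately show "(\<integral>t. \<bar>indicator (if E \<in> Meas then E else {}) t
       - indicator (if F \<in> Meas then F else {}) t\<bar> \<partial>lebesgue_on {0..1}) = lam (sym_diff E F)"
    using EF by (simp add: sets.Diff sets.Un)
qed

lemma ind_Diff:
  assumes "E \<in> Meas" "F \<in> Meas" "F \<subseteq> E"
  shows "ind (E - F) = ind E - ind F"
  using assms
proof transfer
  fix E F assume "E \<in> Meas" "F \<in> Meas" "F \<subseteq> E"
  moreover from \<open>F \<subseteq> E\<close>
  have "indicator (E - F) t = indicator E t - (indicator F t :: real)" for t
    by (auto simp: indicator_def)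
  ultimately show "L1_rel (indicator (if E - F \<in> Meas then E - F else {}))
    (\<lambda>t. indicator (if E \<in> Meas then E else {}) t - indicator (if F \<in> Meas then F else {}) t)"
    by (auto simp: L1_rel_def less_top[symmetric])
qed

section \<open>Weak neighborhoods and the pigeonhole principle\<close>

lemma weak_open_basic:
  fixes x :: "'a::real_normed_vector"
  assumes "openin weak_topology U" "x \<in> U"
  shows "\<exists>(\<Phi> :: ('a \<Rightarrow> real) set) \<delta>. finite \<Phi> \<and> (\<forall>\<phi>\<in>\<Phi>. bounded_linear \<phi>) \<and> 0 < \<delta>
    \<and> {y. \<forall>\<phi>\<in>\<Phi>. \<bar>\<phi> y - \<phi> x\<bar> < \<delta>} \<subseteq> U"
proof -
  let ?B = "{\<phi> -` U | (\<phi> :: 'a \<Rightarrow> real) U. bounded_linear \<phi> \<and> open U}"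
  have "generate_topology_on ?B U"
    using assms(1) by (simp add: weak_topology_def openin_topology_generated_by_iff)
  then show ?thesis
    using assms(2)
  proof (induction rule: generate_topology_on.induct)
    case Empty
    then show ?case by simp
  next
    case (Int a b)
    obtain \<Phi> :: "('a \<Rightarrow> real) set" and \<delta> where 1: "finite \<Phi>" "\<forall>\<phi>\<in>\<Phi>. bounded_linear \<phi>" "0 < \<delta>"
      "{y. \<forall>\<phi>\<in>\<Phi>. \<bar>\<phi> y - \<phi> x\<bar> < \<delta>} \<subseteq> a"
      using Int by blast
    obtain \<Psi> :: "('a \<Rightarrow> real) set" and \<eta> where 2: "finite \<Psi>" "\<forall>\<phi>\<in>\<Psi>. bounded_linear \<phi>" "0 < \<eta>"
      "{y. \<forall>\<phi>\<in>\<Psi>. \<bar>\<phi> y - \<phi> x\<bar> < \<eta>} \<subseteq> b"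
      using Int by blast
    have "{y. \<forall>\<phi>\<in>\<Phi> \<union> \<Psi>. \<bar>\<phi> y - \<phi> x\<bar> < min \<delta> \<eta>} \<subseteq> a \<inter> b"
      using 1(4) 2(4) by auto
    then show ?case
      using 1 2 by (intro exI[of _ "\<Phi> \<union> \<Psi>"] exI[of _ "min \<delta> \<eta>"]) auto
  next
    case (UN K)
    then obtain k where "k \<in> K" "x \<in> k" by auto
    with UN.IH[of k] show ?case by (meson Union_upper subset_trans)
  next
    case (Basis s)
    from Basis.hyps obtain \<phi> :: "'a \<Rightarrow> real" and W
      where s: "s = \<phi> -` W" and \<phi>: "bounded_linear \<phi>" and W: "open W"
      by (elim CollectE exE conjE)
    have "\<phi> x \<in> W"
      using Basis.prems by (simp only: s vimage_eq)
    with W obtain e where e: "e > 0" "ball (\<phi> x) e \<subseteq> W"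
      by (rule openE)
    have "{y. \<forall>\<psi>\<in>{\<phi>}. \<bar>\<psi> y - \<psi> x\<bar> < e} \<subseteq> s"
      using e(2) by (auto simp: s subset_iff dist_real_def abs_minus_commute)
    with \<phi> e(1) show ?case
      by (intro exI[of _ "{\<phi>}"] exI[of _ e]) auto
  qed
qed

text \<open>
  Rounding the values of the functionals down to multiples of \<open>\<delta>\<close> sorts the points of
  \<open>B\<close> into finitely many classes. It suffices that \<open>L\<close> exceeds the number of classes.
\<close>

lemma finitely_many_functionals_pigeonhole:
  fixes \<Phi> :: "('a::real_normed_vector \<Rightarrow> real) set"
  assumes \<Phi>: "finite \<Phi>" "\<And>\<phi>. \<phi> \<in> \<Phi> \<Longrightarrow> bounded_linear \<phi>" and "bounded B" "0 < \<delta>"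
  shows "\<exists>L::nat. \<forall>p. (\<forall>i<L. p i \<in> B) \<longrightarrow>
    (\<exists>i<L. \<exists>j<L. i \<noteq> j \<and> (\<forall>\<phi>\<in>\<Phi>. \<bar>\<phi> (p i) - \<phi> (p j)\<bar> < \<delta>))"
proof -
  define q where "q \<phi> x = \<lfloor>\<phi> x / \<delta>\<rfloor>" for \<phi> :: "'a \<Rightarrow> real" and x
  have "finite (q \<phi> ` B)" if "\<phi> \<in> \<Phi>" for \<phi>
  proof -
    have "bounded (\<phi> ` B)"
      using bounded_linear_image[OF \<open>bounded B\<close> \<Phi>(2)[OF that]] .
    then obtain R where R: "\<And>x. x \<in> B \<Longrightarrow> \<bar>\<phi> x\<bar> \<le> R"
      by (auto simp: bounded_iff)
    have "q \<phi> x \<in> {\<lfloor>- R / \<delta>\<rfloor>..\<lfloor>R / \<delta>\<rfloor>}" if "x \<in> B" for x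
    proof -
      have "- R \<le> \<phi> x" "\<phi> x \<le> R" using R[OF that] by linarith+
      then have "- R / \<delta> \<le> \<phi> x / \<delta>" "\<phi> x / \<delta> \<le> R / \<delta>"
        using \<open>0 < \<delta>\<close> by (intro divide_right_mono; simp)+
      then show ?thesis by (simp only: q_def floor_mono atLeastAtMost_iff simp_thms)
    qed
    then have "q \<phi> ` B \<subseteq> {\<lfloor>- R / \<delta>\<rfloor>..\<lfloor>R / \<delta>\<rfloor>}"
      by blast
    then show ?thesis by (rule finite_subset) simp
  qed
  then have fin: "finite (Pi\<^sub>E \<Phi> (\<lambda>\<phi>. q \<phi> ` B))" (is "finite ?T")
    using \<Phi>(1) by (intro finite_PiE)
  have collision: "\<exists>i<Suc (card ?T). \<exists>j<Suc (card ?T). i \<noteq> j \<and> (\<forall>\<phi>\<in>\<Phi>. \<bar>\<phi> (p i) - \<phi> (p j)\<bar> < \<delta>)"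
    if p: "\<forall>i<Suc (card ?T). p i \<in> B" for p
  proof -
    define c where "c i = (\<lambda>\<phi>\<in>\<Phi>. q \<phi> (p i))" for i
    have "c ` {..<Suc (card ?T)} \<subseteq> ?T"
      using p by (auto simp: c_def)
    then have "card (c ` {..<Suc (card ?T)}) < card {..<Suc (card ?T)}"
      using card_mono[OF fin] by (simp add: less_Suc_eq_le)
    then obtain i j where ij: "i < Suc (card ?T)" "j < Suc (card ?T)" "i \<noteq> j" "c i = c j"
      using pigeonhole[of c "{..<Suc (card ?T)}"] by (auto simp: inj_on_def)
    have "\<bar>\<phi> (p i) - \<phi> (p j)\<bar> < \<delta>" if "\<phi> \<in> \<Phi>" for \<phi>
    proof -
      have "\<lfloor>\<phi> (p i) / \<delta>\<rfloor> = \<lfloor>\<phi> (p j) / \<delta>\<rfloor>"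
        using fun_cong[OF ij(4), of \<phi>] that by (simp add: c_def q_def)
      then have "\<bar>\<phi> (p i) / \<delta> - \<phi> (p j) / \<delta>\<bar> < 1" by linarith
      then have "\<bar>\<phi> (p i) - \<phi> (p j)\<bar> / \<delta> < 1"
        using \<open>0 < \<delta>\<close> by (simp flip: diff_divide_distrib)
      then show ?thesis using \<open>0 < \<delta>\<close> by simp
    qed
    with ij show ?thesis by blast
  qed
  show ?thesis
    by (rule exI[of _ "Suc (card ?T)"], intro allI impI, rule collision)
qed

section \<open>Difference quotients along indicators\<close>

text \<open>
  The divisor \<open>lam E\<close> is the norm of \<open>u - v\<close>. Increments that are indicators are enough,
  and halving the set keeps an increment in this class.
\<close>

definition quotients :: "(L1 \<Rightarrow> 'a::real_normed_vector) \<Rightarrow> 'a set" where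
  "quotients f = {(f u - f v) /\<^sub>R lam E | u v E. E \<in> Meas \<and> 0 < lam E \<and> u - v = ind E}"

lemma quotientsI:
  assumes "E \<in> Meas" "0 < lam E" "u - v = ind E"
  shows "(f u - f v) /\<^sub>R lam E \<in> quotients f"
  using assms unfolding quotients_def by blast

lemma bounded_quotients:
  assumes "\<And>u v. dist (f u) (f v) \<le> C * dist u v"
  shows "bounded (quotients f)"
proof -
  have "norm ((f u - f v) /\<^sub>R lam E) \<le> C"
    if "E \<in> Meas" "0 < lam E" "u - v = ind E" for u v E
  proof -
    have "norm ((f u - f v) /\<^sub>R lam E) = norm (f u - f v) / lam E"
      using that by (simp add: divide_inverse)
    also have "\<dots> \<le> C"
      using assms[of u v] that norm_ind[of E] by (simp add: dist_norm pos_divide_le_eq)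
    finally show ?thesis .
  qed
  then show ?thesis
    by (auto simp: bounded_iff quotients_def intro!: exI[of _ C])
qed

text \<open>
  The point \<open>y\<close> averages a quotient over the lower half of the way from \<open>v\<close> to \<open>u\<close>
  with one over the upper half, where the two halves are taken with respect to different
  midpoints \<open>m i\<close> and \<open>m j\<close>. With the same midpoint the average would be \<open>x\<close>, so the error
  is governed by \<open>f (m i) - f (m j)\<close> alone, which is large in norm but small for the
  finitely many functionals that define \<open>V\<close>.
\<close>

lemma quotient_not_weakly_continuous:
  fixes f :: "L1 \<Rightarrow> 'a::real_normed_vector"
  assumes lower: "\<And>u v. c * dist u v \<le> dist (f u) (f v)"
    and upper: "\<And>u v. dist (f u) (f v) \<le> C * dist u v" and "0 < C"
    and x: "x \<in> quotients f" and V: "weak_neighborhood x V"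
  shows "\<exists>y \<in> V \<inter> convex hull quotients f. c / 2 \<le> dist x y"
proof -
  obtain u v E where E: "E \<in> Meas" and pos: "0 < lam E" and uv: "u - v = ind E"
    and x_eq: "x = (f u - f v) /\<^sub>R lam E"
    using x by (auto simp: quotients_def)
  obtain U where U: "openin weak_topology U" "x \<in> U" "U \<subseteq> V"
    using V unfolding weak_neighborhood_def by blast
  obtain \<Phi> :: "('a \<Rightarrow> real) set" and \<delta>
    where \<Phi>: "finite \<Phi>" "\<forall>\<phi>\<in>\<Phi>. bounded_linear \<phi>" "0 < \<delta>"
    and "{y. \<forall>\<phi>\<in>\<Phi>. \<bar>\<phi> y - \<phi> x\<bar> < \<delta>} \<subseteq> U"
    using weak_open_basic[OF U(1,2)] by blast
  with U(3) have sub: "{y. \<forall>\<phi>\<in>\<Phi>. \<bar>\<phi> y - \<phi> x\<bar> < \<delta>} \<subseteq> V"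
    by blast
  \<comment> \<open>The factor \<open>lam E\<close> compensates for the division by \<open>lam E\<close> in \<open>y - x\<close>.\<close>
  have "0 < \<delta> * lam E" using \<Phi>(3) pos by simp
  then have "\<exists>L::nat. \<forall>p. (\<forall>i<L. p i \<in> cball (f v) (C * lam E)) \<longrightarrow>
      (\<exists>i<L. \<exists>j<L. i \<noteq> j \<and> (\<forall>\<phi>\<in>\<Phi>. \<bar>\<phi> (p i) - \<phi> (p j)\<bar> < \<delta> * lam E))"
    using \<Phi>(1,2) by (intro finitely_many_functionals_pigeonhole) auto
  then obtain L :: nat where L: "\<forall>p. (\<forall>i<L. p i \<in> cball (f v) (C * lam E)) \<longrightarrow>
      (\<exists>i<L. \<exists>j<L. i \<noteq> j \<and> (\<forall>\<phi>\<in>\<Phi>. \<bar>\<phi> (p i) - \<phi> (p j)\<bar> < \<delta> * lam E))"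
    by (rule exE)
  obtain H where "independent_halves E L H"
    using ex_independent_halves[OF E] by blast
  note H = independent_halvesD[OF this]
  define m where "m i = v + ind (H i)" for i
  have "f (m i) \<in> cball (f v) (C * lam E)" if "i < L" for i
  proof -
    have "dist (f v) (f (m i)) \<le> C * (lam E / 2)"
      using upper[of v "m i"] norm_ind[OF H(1)[OF that]] H(3)[OF that]
      by (simp add: m_def dist_norm)
    also have "\<dots> \<le> C * lam E" using \<open>0 < C\<close> pos by simp
    finally show ?thesis by simp
  qed
  then obtain i j where i: "i < L" and j: "j < L" and "i \<noteq> j"
    and close: "\<And>\<phi>. \<phi> \<in> \<Phi> \<Longrightarrow> \<bar>\<phi> (f (m i)) - \<phi> (f (m j))\<bar> < \<delta> * lam E"
    using L[rule_format, of "\<lambda>i. f (m i)"] by blast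
  define y where "y = x + (f (m i) - f (m j)) /\<^sub>R lam E"
  have "y \<in> convex hull quotients f"
  proof -
    have "(f (m i) - f v) /\<^sub>R lam (H i) \<in> quotients f"
      using H(1,3)[OF i] pos by (intro quotientsI) (auto simp: m_def)
    moreover have "(f u - f (m j)) /\<^sub>R lam (E - H j) \<in> quotients f"
    proof (intro quotientsI)
      have "u - m j = ind E - ind (H j)" using uv by (simp add: m_def algebra_simps)
      then show "u - m j = ind (E - H j)" using ind_Diff[OF E H(1) H(2)] j by simp
    qed (use E H(1-3)[OF j] pos in \<open>auto simp: unit_interval.finite_measure_Diff\<close>)
    moreover have "lam (E - H j) = lam E / 2"
      using E H(1-3)[OF j] by (simp add: unit_interval.finite_measure_Diff)
    ultimately have mid: "(1/2) *\<^sub>R ((f (m i) - f v) /\<^sub>R (lam E / 2))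
        + (1/2) *\<^sub>R ((f u - f (m j)) /\<^sub>R (lam E / 2)) \<in> convex hull quotients f"
      using H(3)[OF i] by (intro convexD[OF convex_convex_hull]) (auto intro: hull_inc)
    have half: "(1/2) *\<^sub>R (z /\<^sub>R (lam E / 2)) = z /\<^sub>R lam E" for z :: 'a
      by (simp add: inverse_eq_divide)
    have "(f (m i) - f v) /\<^sub>R lam E + (f u - f (m j)) /\<^sub>R lam E = y"
      by (simp add: y_def x_eq scaleR_diff_right)
    with mid show ?thesis unfolding half by simp
  qed
  moreover have "y \<in> V"
  proof -
    have "\<bar>\<phi> y - \<phi> x\<bar> < \<delta>" if "\<phi> \<in> \<Phi>" for \<phi>
    proof -
      interpret bounded_linear \<phi> using \<Phi>(2) that by blast
      have "\<bar>\<phi> y - \<phi> x\<bar> = \<bar>\<phi> (f (m i)) - \<phi> (f (m j))\<bar> / lam E"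
        using pos by (simp add: y_def add scaleR diff abs_mult divide_inverse)
      then show ?thesis using close[OF that] pos by (simp add: pos_divide_less_eq)
    qed
    then show ?thesis using sub by blast
  qed
  moreover have "c / 2 \<le> dist x y"
  proof -
    have "c * (lam E / 2) \<le> norm (f (m i) - f (m j))"
      using lower[of "m i" "m j"] norm_ind_diff[OF H(1)[OF i] H(1)[OF j]] H(4)[OF i j \<open>i \<noteq> j\<close>]
      by (simp add: m_def dist_norm)
    moreover have "dist x y = norm (f (m i) - f (m j)) / lam E"
      using pos by (simp add: y_def dist_norm divide_inverse)
    ultimately show ?thesis using pos by (simp add: pos_le_divide_eq)
  qed
  ultimately show ?thesis by blast
qed

section \<open>Failure of the slice point of continuity property\<close>

theorem corollary7p8:
  assumes "\<exists>f :: L1 \<Rightarrow> 'a::banach. bilipschitz_embedding f"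
  shows "\<not> slice_PCP TYPE('a)"
proof
  assume PCP: "slice_PCP TYPE('a)"
  obtain f :: "L1 \<Rightarrow> 'a" and c C where "0 < c" "0 < C"
    and lower: "\<And>u v. c * dist u v \<le> dist (f u) (f v)"
    and upper: "\<And>u v. dist (f u) (f v) \<le> C * dist u v"
    using assms unfolding bilipschitz_embedding_def by blast
  let ?D = "quotients f" and ?A = "convex hull quotients f"
  have "{0..1} \<in> Meas" "lam {0..1} = 1"
    by (auto simp: sets_restrict_space_iff measure_restrict_space)
  then have "?D \<noteq> {}"
    using quotientsI[of "{0..1}" "ind {0..1}" 0 f] by auto
  moreover have bdd: "bounded ?A"
    using bounded_quotients[of f C] upper by (simp add: bounded_convex_hull)
  ultimately obtain S where S: "open_halfspace S" "S \<inter> ?A \<noteq> {}"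
    and small: "\<And>x. x \<in> S \<inter> ?A \<Longrightarrow> \<exists>V. weak_neighborhood x V \<and> diameter (V \<inter> ?A) < c / 2"
    using PCP[unfolded slice_PCP_def, rule_format, of ?A "c / 2"] \<open>0 < c\<close> by auto
  obtain \<phi> :: "'a \<Rightarrow> real" and a where \<phi>: "bounded_linear \<phi>" and S_eq: "S = {x. \<phi> x > a}"
    using S(1) unfolding open_halfspace_def by blast
  have "S \<inter> ?D \<noteq> {}"
  proof
    assume "S \<inter> ?D = {}"
    then have "?D \<subseteq> \<phi> -` {..a}" by (auto simp: S_eq disjoint_iff not_less)
    moreover have "convex (\<phi> -` {..a})"
      using \<phi> by (intro convex_linear_vimage bounded_linear.linear) auto
    ultimately have "?A \<subseteq> \<phi> -` {..a}" by (rule hull_minimal)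
    then show False using S(2) by (auto simp: S_eq)
  qed
  then obtain x where x: "x \<in> S" "x \<in> ?D" by blast
  then have "x \<in> S \<inter> ?A" by (simp add: hull_inc)
  then obtain V where V: "weak_neighborhood x V" and diam: "diameter (V \<inter> ?A) < c / 2"
    using small by blast
  obtain y where "y \<in> V \<inter> ?A" "c / 2 \<le> dist x y"
    using quotient_not_weakly_continuous[OF lower upper \<open>0 < C\<close> x(2) V] by blast
  moreover have "x \<in> V \<inter> ?A"
    using V \<open>x \<in> S \<inter> ?A\<close> by (auto simp: weak_neighborhood_def)
  moreover have "bounded (V \<inter> ?A)" using bdd by (rule bounded_subset) simp
  ultimately show False
    using diameter_bounded_bound[of "V \<inter> ?A" x y] diam by linarith
qed

end
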